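(* Suppose $\phi$ is an absolute value on a commutative semigroup $S$ with involution and $d$ is any positive integer. Then the closure of the cone $\sum A_S^{2d}$ in $A_S$ in the topology induced by the $\phi$-seminorm is equal to $\operatorname{Pos}(\mathcal{K}_{\phi})$.
   Context: A commutative semigroup with involution $S=(S,\cdot,1,* )$ is a commutative semigroup with neutral element $1$ and a map $*:S\to S$ with $(st)^*=s^*t^*$, $(s^* )^*=s$, $1^*=1$. $\mathbb{C}[S]$ is the semigroup algebra, with elements the finite sums $f=\sum_{s\in S}f_s s$, $f_s\in\mathbb{C}$, and involution $f^*=\sum\overline{f_s}s^*$. $A_S:=\{f\in\mathbb{C}[S] : f^*=f\}$ is the $\mathbb{R}$-algebra of symmetric elements, and $\sum A_S^{2d}$ is the set of finite sums of $2d$-th powers of elements of $A_S$. A semicharacter of $S$ is a function $\alpha:S\to\mathbb{C}$ with $\alpha(1)=1$, $\alpha(st)=\alpha(s)\alpha(t)$, $\alpha(s^* )=\overline{\alpha(s)}$ for all $s,t\in S$; $S'$ is the set of semicharacters. Each $\alpha\in S'$ extends to $\mathbb{C}[S]$ by $\alpha(f)=\sum_s f_s\alpha(s)$, and takes real values on $A_S$. An absolute value on $S$ is a function $\phi:S\to\mathbb{R}_{\ge 0}$ with $\phi(1)\ge 1$, $\phi(st)\le\phi(s)\phi(t)$ and $\phi(s^* )=\phi(s)$ for all $s,t\in S$. The $\phi$-seminorm is $\|f\|_{\phi}:=\sum_s|f_s|\phi(s)$. $\mathcal{K}_{\phi}:=\{\alpha\in S' : |\alpha(s)|\le\phi(s)\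 \forall s\in S\}$ and $\operatorname{Pos}(\mathcal{K}_{\phi}):=\{f\in A_S : \alpha(f)\ge 0\ \forall\alpha\in\mathcal{K}_{\phi}\}$. *)

theory Defs
  imports "HOL-Analysis.Analysis" "HOL-Library.Poly_Mapping" "HOL-Library.Nonpos_Ints"
begin

text \<open>
  The semigroup is the whole of a type of class \<^class>\<open>comm_monoid_add\<close>, written additively:
  the product \<open>s t\<close> is \<open>s + t\<close> and the neutral element \<open>1\<close> is \<open>0\<close>.  The semigroup
  algebra is then \<open>'a \<Rightarrow>\<^sub>0 complex\<close>, whose ring structure in \<^theory>\<open>HOL-Library.Poly_Mapping\<close>
  is convolution; the element \<open>s\<close> of the semigroup is \<open>Poly_Mapping.single s 1\<close>.
\<close>

definition semigroup_involution :: "('a::comm_monoid_add \<Rightarrow> 'a) \<Rightarrow> bool" where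
  "semigroup_involution star \<longleftrightarrow>
     (\<forall>s t. star (s + t) = star s + star t) \<and> (\<forall>s. star (star s) = s) \<and> star 0 = 0"

definition algebra_involution ::
    "('a::comm_monoid_add \<Rightarrow> 'a) \<Rightarrow> ('a \<Rightarrow>\<^sub>0 complex) \<Rightarrow> ('a \<Rightarrow>\<^sub>0 complex)" where
  "algebra_involution star f =
     (\<Sum>s\<in>Poly_Mapping.keys f. Poly_Mapping.single (star s) (cnj (Poly_Mapping.lookup f s)))"

definition symmetric_elements :: "('a::comm_monoid_add \<Rightarrow> 'a) \<Rightarrow> ('a \<Rightarrow>\<^sub>0 complex) set" where
  "symmetric_elements star = {f. algebra_involution star f = f}"

definition sums_of_powers :: "('a::comm_monoid_add \<Rightarrow> 'a) \<Rightarrow> nat \<Rightarrow> ('a \<Rightarrow>\<^sub>0 complex) set" where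
  "sums_of_powers star k =
     {(\<Sum>i<n. g i ^ k) | (n::nat) g. \<forall>i<n. g i \<in> symmetric_elements star}"

definition semicharacters :: "('a::comm_monoid_add \<Rightarrow> 'a) \<Rightarrow> ('a \<Rightarrow> complex) set" where
  "semicharacters star = {\<alpha>. \<alpha> 0 = 1 \<and> (\<forall>s t. \<alpha> (s + t) = \<alpha> s * \<alpha> t) \<and>
     (\<forall>s. \<alpha> (star s) = cnj (\<alpha> s))}"

definition extend :: "('a \<Rightarrow> complex) \<Rightarrow> ('a \<Rightarrow>\<^sub>0 complex) \<Rightarrow> complex" where
  "extend \<alpha> f = (\<Sum>s\<in>Poly_Mapping.keys f. Poly_Mapping.lookup f s * \<alpha> s)"

definition absolute_value :: "('a::comm_monoid_add \<Rightarrow> 'a) \<Rightarrow> ('a \<Rightarrow> real) \<Rightarrow> bool" where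
  "absolute_value star \<phi> \<longleftrightarrow> (\<forall>s. 0 \<le> \<phi> s) \<and> 1 \<le> \<phi> 0 \<and>
     (\<forall>s t. \<phi> (s + t) \<le> \<phi> s * \<phi> t) \<and> (\<forall>s. \<phi> (star s) = \<phi> s)"

definition phi_seminorm :: "('a \<Rightarrow> real) \<Rightarrow> ('a \<Rightarrow>\<^sub>0 complex) \<Rightarrow> real" where
  "phi_seminorm \<phi> f = (\<Sum>s\<in>Poly_Mapping.keys f. cmod (Poly_Mapping.lookup f s) * \<phi> s)"

text \<open>
  The topology need not be Hausdorff (\<open>\<phi>\<close> may vanish somewhere), so the metric space locales
  do not apply and the topology is given by its open sets.
\<close>

definition phi_topology ::
    "('a::comm_monoid_add \<Rightarrow> 'a) \<Rightarrow> ('a \<Rightarrow> real) \<Rightarrow> ('a \<Rightarrow>\<^sub>0 complex) topology" where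
  "phi_topology star \<phi> = topology (\<lambda>U. U \<subseteq> symmetric_elements star \<and>
     (\<forall>f\<in>U. \<exists>\<epsilon>>0. \<forall>g\<in>symmetric_elements star. phi_seminorm \<phi> (g - f) < \<epsilon> \<longrightarrow> g \<in> U))"

definition K_phi :: "('a::comm_monoid_add \<Rightarrow> 'a) \<Rightarrow> ('a \<Rightarrow> real) \<Rightarrow> ('a \<Rightarrow> complex) set" where
  "K_phi star \<phi> = {\<alpha> \<in> semicharacters star. \<forall>s. cmod (\<alpha> s) \<le> \<phi> s}"

text \<open>
  Nonnegativity of the complex number \<open>extend \<alpha> f\<close> is membership in \<open>\<real>\<^sub>\<ge>\<^sub>0\<close>; that the value is
  real is automatic for symmetric \<open>f\<close>, see \<open>extend_symmetric_real\<close>.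
\<close>

definition Pos :: "('a::comm_monoid_add \<Rightarrow> 'a) \<Rightarrow> ('a \<Rightarrow> complex) set \<Rightarrow> ('a \<Rightarrow>\<^sub>0 complex) set" where
  "Pos star K = {f \<in> symmetric_elements star. \<forall>\<alpha>\<in>K. extend \<alpha> f \<in> \<real>\<^sub>\<ge>\<^sub>0}"

lemma openin_phi_topology:
  "openin (phi_topology star \<phi>) U \<longleftrightarrow> U \<subseteq> symmetric_elements star \<and>
     (\<forall>f\<in>U. \<exists>\<epsilon>>0. \<forall>g\<in>symmetric_elements star. phi_seminorm \<phi> (g - f) < \<epsilon> \<longrightarrow> g \<in> U)"
proof -
  have "istopology (\<lambda>U. U \<subseteq> symmetric_elements star \<and>
     (\<forall>f\<in>U. \<exists>\<epsilon>>0. \<forall>g\<in>symmetric_elements star. phi_seminorm \<phi> (g - f) < \<epsilon> \<longrightarrow> g \<in> U))"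
    (is "istopology ?L")
    unfolding istopology_def
  proof (intro conjI allI impI)
    fix S T assume S: "?L S" and T: "?L T"
    show "S \<inter> T \<subseteq> symmetric_elements star" using S by blast
    show "\<forall>f\<in>S \<inter> T. \<exists>\<epsilon>>0. \<forall>g\<in>symmetric_elements star.
        phi_seminorm \<phi> (g - f) < \<epsilon> \<longrightarrow> g \<in> S \<inter> T"
    proof
      fix f assume f: "f \<in> S \<inter> T"
      obtain a where a: "a > 0" "\<forall>g\<in>symmetric_elements star. phi_seminorm \<phi> (g - f) < a \<longrightarrow> g \<in> S"
        using S f by blast
      obtain b where b: "b > 0" "\<forall>g\<in>symmetric_elements star. phi_seminorm \<phi> (g - f) < b \<longrightarrow> g \<in> T"
        using T f by blast
      show "\<exists>\<epsilon>>0. \<forall>g\<in>symmetric_elements star. phi_seminorm \<phi> (g - f) < \<epsilon> \<longrightarrow> g \<in> S \<inter> T"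
        by (rule exI[of _ "min a b"]) (use a b in auto)
    qed
  next
    fix \<K> assume K: "\<forall>k\<in>\<K>. ?L k"
    show "\<Union>\<K> \<subseteq> symmetric_elements star" using K by blast
    show "\<forall>f\<in>\<Union>\<K>. \<exists>\<epsilon>>0. \<forall>g\<in>symmetric_elements star.
        phi_seminorm \<phi> (g - f) < \<epsilon> \<longrightarrow> g \<in> \<Union>\<K>"
      using K by (meson UnionE UnionI)
  qed
  then show ?thesis by (simp add: phi_topology_def)
qed

lemma topspace_phi_topology: "topspace (phi_topology star \<phi>) = symmetric_elements star"
proof (rule antisym)
  show "topspace (phi_topology star \<phi>) \<subseteq> symmetric_elements star"
    using openin_topspace[of "phi_topology star \<phi>"] unfolding openin_phi_topology by blast
  have "openin (phi_topology star \<phi>) (symmetric_elements star)"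
    unfolding openin_phi_topology by (auto intro: exI[of _ 1])
  then show "symmetric_elements star \<subseteq> topspace (phi_topology star \<phi>)"
    by (rule openin_subset)
qed

lemma extend_superset:
  assumes "finite B" "Poly_Mapping.keys f \<subseteq> B"
  shows "extend \<alpha> f = (\<Sum>s\<in>B. Poly_Mapping.lookup f s * \<alpha> s)"
  unfolding extend_def using assms
  by (intro sum.mono_neutral_left) (auto simp: in_keys_iff)

lemma extend_add: "extend \<alpha> (f + g) = extend \<alpha> f + extend \<alpha> g"
proof -
  let ?B = "Poly_Mapping.keys f \<union> Poly_Mapping.keys g"
  have "Poly_Mapping.keys (f + g) \<subseteq> ?B" by (rule Poly_Mapping.keys_add)
  then show ?thesis
    using extend_superset[of ?B f \<alpha>] extend_superset[of ?B g \<alpha>] extend_superset[of ?B "f + g" \<alpha>]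
    by (simp add: lookup_add distrib_right sum.distrib)
qed

lemma extend_sum: "extend \<alpha> (\<Sum>i\<in>I. f i) = (\<Sum>i\<in>I. extend \<alpha> (f i))"
  by (induction I rule: infinite_finite_induct) (simp_all add: extend_add, simp_all add: extend_def)

lemma extend_single: "extend \<alpha> (Poly_Mapping.single s c) = c * \<alpha> s"
  by (simp add: extend_def)

lemma extend_symmetric_real:
  assumes "\<alpha> \<in> semicharacters star" "f \<in> symmetric_elements star"
  shows "extend \<alpha> f \<in> \<real>"
proof -
  have "extend \<alpha> f = extend \<alpha> (algebra_involution star f)"
    using assms(2) by (simp add: symmetric_elements_def)
  also have "\<dots> = cnj (extend \<alpha> f)"
    using assms(1)
    by (simp add: algebra_involution_def extend_sum extend_single semicharacters_def extend_def[of \<alpha> f])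
  finally show ?thesis by (simp add: Reals_cnj_iff)
qed

end

theory Submission
  imports Defs
begin

text \<open>
  Every element of the closed cone evaluates nonnegatively at \<open>\<alpha> \<in> K_phi\<close>, because \<open>extend \<alpha>\<close> is a
  contraction for the seminorm. Conversely, let \<open>T\<close> be the closure of the sums of \<open>2d\<close>-th powers.
  It is closed under addition and multiplication, and the binomial series for \<open>(1 + a) powr (1 / (2d))\<close>
  shows that \<open>r + a \<in> T\<close> whenever \<open>r > \<parallel>a\<parallel>\<close>; so \<open>T\<close> is an archimedean semiring and every real
  character that is nonnegative on \<open>T\<close> is bounded by the seminorm, i.e. comes from \<open>K_phi\<close>.
  Krivine's representation theorem for archimedean semirings then puts \<open>f + \<epsilon>\<close> into \<open>T\<close> for
  every \<open>f \<in> Pos\<close> and \<open>\<epsilon> > 0\<close>, and \<open>T\<close> is closed.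
\<close>

section \<open>Archimedean semirings\<close>

text \<open>The algebra is a subset of a larger ring because the intended instance, the symmetric
  elements, is only a real form of the complex semigroup algebra. Scalars enter through
  \<open>\<iota>\<close>.\<close>

locale real_subalgebra =
  fixes A :: "'r::comm_ring_1 set" and \<iota> :: "real \<Rightarrow> 'r"
  assumes iota_1: "\<iota> 1 = 1"
    and iota_add: "\<iota> (x + y) = \<iota> x + \<iota> y"
    and iota_mult: "\<iota> (x * y) = \<iota> x * \<iota> y"
    and iota_in: "\<iota> x \<in> A"
    and add_in: "a \<in> A \<Longrightarrow> b \<in> A \<Longrightarrow> a + b \<in> A"
    and mult_in: "a \<in> A \<Longrightarrow> b \<in> A \<Longrightarrow> a * b \<in> A"
begin

lemma iota_0: "\<iota> 0 = 0"
  using iota_add[of 0 0] by simp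

lemma iota_minus: "\<iota> (- x) = - \<iota> x"
  using iota_add[of x "- x"] by (simp add: iota_0 eq_neg_iff_add_eq_0 add.commute)

lemma iota_diff: "\<iota> (x - y) = \<iota> x - \<iota> y"
  using iota_add[of x "- y"] by (simp add: iota_minus)

lemma iota_power: "\<iota> (x ^ n) = \<iota> x ^ n"
  by (induction n) (simp_all add: iota_1 iota_mult)

lemma iota_sum: "\<iota> (\<Sum>i\<in>I. f i) = (\<Sum>i\<in>I. \<iota> (f i))"
  by (induction I rule: infinite_finite_induct) (simp_all add: iota_0 iota_add)

lemma minus_in: "a \<in> A \<Longrightarrow> - a \<in> A"
  using mult_in[OF iota_in[of "-1"], of a] by (simp add: iota_minus iota_1)

lemma diff_in: "a \<in> A \<Longrightarrow> b \<in> A \<Longrightarrow> a - b \<in> A"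
  using add_in[OF _ minus_in, of a b] by simp

lemma one_in: "1 \<in> A"
  using iota_in[of 1] by (simp add: iota_1)

lemma power_in: "a \<in> A \<Longrightarrow> a ^ n \<in> A"
  by (induction n) (simp_all add: one_in mult_in)

lemma sum_in: "(\<And>i. i \<in> I \<Longrightarrow> f i \<in> A) \<Longrightarrow> (\<Sum>i\<in>I. f i) \<in> A"
  using iota_in[of 0] by (induction I rule: infinite_finite_induct) (simp_all add: iota_0 add_in)

text \<open>Fixing the scalars makes \<open>\<alpha>\<close> unital and, by multiplicativity,
  real-linear on \<open>A\<close>; its values off \<open>A\<close> are arbitrary.\<close>

definition real_character :: "('r \<Rightarrow> real) \<Rightarrow> bool" where
  "real_character \<alpha> \<longleftrightarrow>
     (\<forall>a\<in>A. \<forall>b\<in>A. \<alpha> (a + b) = \<alpha> a + \<alpha> b \<and> \<alpha> (a * b) = \<alpha> a * \<alpha> b) \<and> (\<forall>r. \<alpha> (\<iota> r) = r)"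

lemma real_character_minus:
  assumes "real_character \<alpha>" "a \<in> A"
  shows "\<alpha> (- a) = - \<alpha> a"
proof -
  have "\<alpha> (\<iota> (-1) * a) = \<alpha> (\<iota> (-1)) * \<alpha> a"
    using assms iota_in by (auto simp: real_character_def)
  moreover have "\<alpha> (\<iota> (-1)) = -1" using assms by (simp add: real_character_def)
  ultimately show ?thesis by (simp add: iota_minus iota_1)
qed

end

section \<open>Modules over an archimedean semiring\<close>

text \<open>A semiring rather than a preordering: closures of sums of \<open>2d\<close>-th powers
  are visibly closed under products, but that they contain all squares is not known in
  advance.\<close>

locale archimedean_semiring = real_subalgebra A \<iota>
  for A :: "'r::comm_ring_1 set" and \<iota> :: "real \<Rightarrow> 'r" +
  fixes T :: "'r set"
  assumes T_subset: "T \<subseteq> A"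
    and T_add: "s \<in> T \<Longrightarrow> t \<in> T \<Longrightarrow> s + t \<in> T"
    and T_mult: "s \<in> T \<Longrightarrow> t \<in> T \<Longrightarrow> s * t \<in> T"
    and T_iota: "0 \<le> r \<Longrightarrow> \<iota> r \<in> T"
    and archimedean: "a \<in> A \<Longrightarrow> \<exists>r. \<iota> r + a \<in> T"
begin

lemma archimedean_nonneg:
  assumes "a \<in> A"
  shows "\<exists>r\<ge>0. \<iota> r + a \<in> T"
proof -
  obtain r where "\<iota> r + a \<in> T" using archimedean assms by blast
  then have "\<iota> (max r 0 - r) + (\<iota> r + a) \<in> T" using T_add T_iota[of "max r 0 - r"] by simp
  then have "\<iota> (max r 0) + a \<in> T" by (simp add: iota_diff)
  then show ?thesis by (intro exI[of _ "max r 0"]) simp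
qed

text \<open>The condition \<open>- 1 \<notin> M\<close> expresses \<open>M \<noteq> A\<close>: if
  \<open>- 1 \<in> M\<close>, every \<open>a = (r + a) + r (- 1)\<close> with
  \<open>r \<ge> 0\<close> and \<open>r + a \<in> T\<close> would lie in \<open>M\<close>.\<close>

definition proper_module :: "'r set \<Rightarrow> bool" where
  "proper_module M \<longleftrightarrow> T \<subseteq> M \<and> M \<subseteq> A \<and> (\<forall>a\<in>M. \<forall>b\<in>M. a + b \<in> M) \<and>
     (\<forall>t\<in>T. \<forall>a\<in>M. t * a \<in> M) \<and> - 1 \<notin> M"

text \<open>The closure conditions involve at most two elements of the module, so they pass to
  unions of chains and Zorn's lemma applies.\<close>

lemma maximal_proper_module:
  assumes "proper_module M0"
  obtains M where "proper_module M" "M0 \<subseteq> M" "\<And>X. proper_module X \<Longrightarrow> M \<subseteq> X \<Longrightarrow> X = M"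
proof -
  let ?\<A> = "{M. proper_module M \<and> M0 \<subseteq> M}"
  have "\<exists>M\<in>?\<A>. \<forall>X\<in>?\<A>. M \<subseteq> X \<longrightarrow> X = M"
  proof (rule subset_Zorn_nonempty)
    show "?\<A> \<noteq> {}" using assms by blast
    fix \<C> assume ne: "\<C> \<noteq> {}" and ch: "subset.chain ?\<A> \<C>"
    have mem: "proper_module X" "M0 \<subseteq> X" if "X \<in> \<C>" for X
      using ch that by (auto simp: subset.chain_def)
    have "a + b \<in> \<Union>\<C>" if "a \<in> \<Union>\<C>" "b \<in> \<Union>\<C>" for a b
    proof -
      obtain X Y where XY: "X \<in> \<C>" "a \<in> X" "Y \<in> \<C>" "b \<in> Y" using \<open>a \<in> \<Union>\<C>\<close> \<open>b \<in> \<Union>\<C>\<close> by blast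
      then have "X \<subseteq> Y \<or> Y \<subseteq> X" using ch by (auto simp: subset_chain_def)
      with XY mem show ?thesis unfolding proper_module_def by blast
    qed
    moreover have "T \<subseteq> \<Union>\<C>" "M0 \<subseteq> \<Union>\<C>" "\<Union>\<C> \<subseteq> A" "- 1 \<notin> \<Union>\<C>"
      using ne mem unfolding proper_module_def by blast+
    moreover have "t * a \<in> \<Union>\<C>" if "t \<in> T" "a \<in> \<Union>\<C>" for t a
      using that mem unfolding proper_module_def by blast
    ultimately show "\<Union>\<C> \<in> ?\<A>" by (simp add: proper_module_def)
  qed
  then show ?thesis
  proof (rule bexE)
    fix M assume M: "M \<in> ?\<A>" and max: "\<forall>X\<in>?\<A>. M \<subseteq> X \<longrightarrow> X = M"
    show ?thesis
    proof (rule that[of M])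
      show "proper_module M" "M0 \<subseteq> M" using M by simp_all
      show "X = M" if "proper_module X" "M \<subseteq> X" for X
        using max[rule_format, of X] that M by blast
    qed
  qed
qed

text \<open>If neither \<open>a\<close> nor \<open>- a\<close> lies in \<open>M\<close>, maximality gives
  \<open>- 1 = m + t a = m' - t' a\<close>. Eliminating \<open>a\<close> yields \<open>- t \<in> M\<close>, and writing
  \<open>t a = t (n + a) + n (- t)\<close> with \<open>n + a \<in> T\<close> gives \<open>t a \<in> M\<close>, hence \<open>- 1 \<in> M\<close>.\<close>

lemma maximal_module_total:
  assumes M: "proper_module M" and max: "\<And>X. proper_module X \<Longrightarrow> M \<subseteq> X \<Longrightarrow> X = M"
    and a: "a \<in> A"
  shows "a \<in> M \<or> - a \<in> M"
proof (rule ccontr)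
  assume contra: "\<not> (a \<in> M \<or> - a \<in> M)"
  have M': "T \<subseteq> M" "M \<subseteq> A" "\<And>a b. a \<in> M \<Longrightarrow> b \<in> M \<Longrightarrow> a + b \<in> M"
    "\<And>t a. t \<in> T \<Longrightarrow> a \<in> M \<Longrightarrow> t * a \<in> M" "- 1 \<notin> M"
    using M unfolding proper_module_def by auto
  have zero: "0 \<in> T" and one: "1 \<in> T"
    using T_iota[of 0] T_iota[of 1] by (simp_all add: iota_0 iota_1)
  \<comment> \<open>\<open>M + T b\<close> is a module strictly larger than \<open>M\<close>, so by
    maximality it is not proper and contains \<open>- 1\<close>.\<close>
  have witness: "\<exists>m\<in>M. \<exists>t\<in>T. - 1 = m + t * b" if b: "b \<in> A" "b \<notin> M" for b
  proof (rule ccontr)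
    assume no: "\<not> ?thesis"
    let ?X = "{m + t * b |m t. m \<in> M \<and> t \<in> T}"
    have "M \<subseteq> ?X" using zero by force
    moreover have "b \<in> ?X" using one zero M'(1) by force
    moreover have "proper_module ?X"
      unfolding proper_module_def
    proof (intro conjI ballI)
      show "T \<subseteq> ?X" using \<open>M \<subseteq> ?X\<close> M'(1) by blast
      show "?X \<subseteq> A" using M'(2) b(1) T_subset by (auto intro!: add_in mult_in)
      show "- 1 \<notin> ?X" using no by blast
    next
      fix x y assume "x \<in> ?X" "y \<in> ?X"
      then obtain m t m' t' where "x = m + t * b" "y = m' + t' * b"
        and "m \<in> M" "t \<in> T" "m' \<in> M" "t' \<in> T" by blast
      moreover from this have "x + y = (m + m') + (t + t') * b" by (simp add: algebra_simps)
      ultimately show "x + y \<in> ?X" using M'(3) T_add by blast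
    next
      fix s x assume "s \<in> T" "x \<in> ?X"
      then obtain m t where "x = m + t * b" "m \<in> M" "t \<in> T" by blast
      moreover from this have "s * x = s * m + (s * t) * b" by (simp add: algebra_simps)
      ultimately show "s * x \<in> ?X" using \<open>s \<in> T\<close> M'(4) T_mult by blast
    qed
    ultimately show False using max b(2) by blast
  qed
  obtain m t where mt: "m \<in> M" "t \<in> T" "- 1 = m + t * a"
    using witness[of a] contra a by blast
  obtain m' t' where mt': "m' \<in> M" "t' \<in> T" "- 1 = m' + t' * (- a)"
    using witness[of "- a"] contra a minus_in by blast
  \<comment> \<open>Weighting the equation for \<open>a\<close> by \<open>t'\<close> and the one for
    \<open>- a\<close> by \<open>t\<close> cancels \<open>t t' a\<close>; adding
    \<open>t' \<in> T\<close> to the result then leaves \<open>- t\<close>.\<close>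
  have "- (t + t') = t' * (- 1) + t * (- 1)" by simp
  also have "\<dots> = t' * (m + t * a) + t * (m' + t' * (- a))"
    using mt(3) mt'(3) by simp
  also have "\<dots> = t' * m + t * m'" by (simp add: algebra_simps)
  finally have "- (t + t') \<in> M" using mt mt' M' by simp
  then have "- (t + t') + t' \<in> M" using mt'(2) M'(1,3) by blast
  then have neg: "- t \<in> M" by simp
  obtain n where n: "n \<ge> 0" "\<iota> n + a \<in> T" using archimedean_nonneg a by blast
  have "t * (\<iota> n + a) \<in> M" using mt(2) n(2) M'(1,4) by blast
  moreover have "\<iota> n * (- t) \<in> M" using neg n(1) T_iota M'(4) by blast
  ultimately have "t * (\<iota> n + a) + \<iota> n * (- t) \<in> M" by (rule M'(3))
  then have "t * a \<in> M" by (simp add: algebra_simps)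
  then show False using mt M'(3,5) by metis
qed

text \<open>The elements infinitesimal with respect to \<open>M\<close> form an ideal \<open>I\<close>, and the order completeness of
  the reals together with the totality of \<open>M\<close> shows that \<open>A = I + \<real>\<close>; the character is the
  projection to \<open>\<real>\<close>.\<close>

lemma character_of_maximal_module:
  assumes M: "proper_module M" and max: "\<And>X. proper_module X \<Longrightarrow> M \<subseteq> X \<Longrightarrow> X = M"
  shows "\<exists>\<alpha>. real_character \<alpha> \<and> (\<forall>a\<in>M. 0 \<le> \<alpha> a)"
proof -
  have M': "T \<subseteq> M" "M \<subseteq> A" "\<And>a b. a \<in> M \<Longrightarrow> b \<in> M \<Longrightarrow> a + b \<in> M"
    "\<And>t a. t \<in> T \<Longrightarrow> a \<in> M \<Longrightarrow> t * a \<in> M" "- 1 \<notin> M"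
    using M unfolding proper_module_def by auto
  \<comment> \<open>A negative scalar in \<open>M\<close> could be rescaled by a positive one to
    \<open>- 1\<close>.\<close>
  have iota_M: "\<iota> r \<in> M \<longleftrightarrow> 0 \<le> r" for r
  proof
    assume r: "\<iota> r \<in> M"
    show "0 \<le> r"
    proof (rule ccontr)
      assume "\<not> 0 \<le> r"
      then have "\<iota> (- (1 / r)) * \<iota> r \<in> M" using r by (intro M'(4) T_iota) (auto simp: divide_nonpos_neg)
      then show False using M'(5) \<open>\<not> 0 \<le> r\<close> by (simp flip: iota_mult add: iota_minus iota_1)
    qed
  qed (use M'(1) T_iota in blast)
  define I where "I = {b \<in> A. \<forall>\<epsilon>>0. \<iota> \<epsilon> + b \<in> M \<and> \<iota> \<epsilon> - b \<in> M}"
  have I_D: "\<iota> \<epsilon> + b \<in> M" "\<iota> \<epsilon> - b \<in> M" if "b \<in> I" "\<epsilon> > 0" for b \<epsilon>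
    using that by (simp_all add: I_def)
  have I_add: "b + c \<in> I" if b: "b \<in> I" and c: "c \<in> I" for b c
  proof -
    have "\<iota> \<epsilon> + (b + c) \<in> M \<and> \<iota> \<epsilon> - (b + c) \<in> M" if "\<epsilon> > 0" for \<epsilon>
    proof -
      have h: "\<epsilon> / 2 > 0" using that by simp
      have e: "\<iota> \<epsilon> = \<iota> (\<epsilon> / 2) + \<iota> (\<epsilon> / 2)" by (simp flip: iota_add)
      have "(\<iota> (\<epsilon> / 2) + b) + (\<iota> (\<epsilon> / 2) + c) \<in> M" "(\<iota> (\<epsilon> / 2) - b) + (\<iota> (\<epsilon> / 2) - c) \<in> M"
        by (rule M'(3)[OF I_D(1)[OF b h] I_D(1)[OF c h]], rule M'(3)[OF I_D(2)[OF b h] I_D(2)[OF c h]])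
      then show ?thesis unfolding e by (simp add: algebra_simps)
    qed
    then show ?thesis using b c by (auto simp: I_def intro: add_in)
  qed
  have I_minus: "- b \<in> I" if "b \<in> I" for b
    using that by (auto simp: I_def minus_in)
  have I_zero: "0 \<in> I" using iota_in[of 0] by (simp add: I_def iota_M iota_0)
  have I_T: "t * b \<in> I" if t: "t \<in> T" and b: "b \<in> I" for t b
  proof -
    obtain n where n: "n \<ge> 0" "\<iota> n + - t \<in> T"
      using archimedean_nonneg[of "- t"] t T_subset minus_in by blast
    have "\<iota> \<epsilon> + t * b \<in> M \<and> \<iota> \<epsilon> - t * b \<in> M" if "\<epsilon> > 0" for \<epsilon>
    proof -
      \<comment> \<open>Here \<open>\<epsilon> = \<delta> + \<delta> n\<close>, and \<open>\<delta>
        (n - t) + t (\<delta> \<plusminus> b) = \<delta> n \<plusminus> t b\<close>. The 1 in the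
        denominator covers \<open>n = 0\<close>.\<close>
      let ?\<delta> = "\<epsilon> / (n + 1)"
      have d: "?\<delta> > 0" using that n(1) by simp
      have split: "\<iota> \<epsilon> = \<iota> ?\<delta> + \<iota> ?\<delta> * \<iota> n"
      proof -
        have "\<epsilon> = ?\<delta> * (n + 1)" using n(1) by simp
        then have "\<epsilon> = ?\<delta> + ?\<delta> * n" by (simp only: distrib_left mult_1_right add.commute)
        then show ?thesis by (metis iota_add iota_mult)
      qed
      have "\<iota> ?\<delta> \<in> T" using d by (intro T_iota) simp
      then have r: "\<iota> ?\<delta> + \<iota> ?\<delta> * (\<iota> n + - t) \<in> M"
        using T_add[OF _ T_mult[OF _ n(2)]] M'(1) by blast
      have "t * (\<iota> ?\<delta> + b) \<in> M" "t * (\<iota> ?\<delta> - b) \<in> M"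
        using M'(4)[OF t I_D(1)[OF b d]] M'(4)[OF t I_D(2)[OF b d]] by simp_all
      then have "(\<iota> ?\<delta> + \<iota> ?\<delta> * (\<iota> n + - t)) + t * (\<iota> ?\<delta> + b) \<in> M"
        "(\<iota> ?\<delta> + \<iota> ?\<delta> * (\<iota> n + - t)) + t * (\<iota> ?\<delta> - b) \<in> M"
        using r M'(3) by blast+
      then show ?thesis unfolding split by (simp add: algebra_simps)
    qed
    then show ?thesis using b t T_subset by (auto simp: I_def intro: mult_in)
  qed
  have I_mult: "a * b \<in> I" if a: "a \<in> A" and b: "b \<in> I" for a b
  proof -
    obtain n where n: "n \<ge> 0" "\<iota> n + a \<in> T" using archimedean_nonneg a by blast
    \<comment> \<open>\<open>a\<close> is the difference of \<open>n + a\<close> and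
      \<open>n\<close>, both in \<open>T\<close>, to which \<open>I_T\<close> applies.\<close>
    have "(\<iota> n + a) * b + - (\<iota> n * b) \<in> I"
      using n b by (intro I_add I_minus I_T T_iota)
    then show ?thesis by (simp add: algebra_simps)
  qed
  have I_iota: "x = 0" if "\<iota> x \<in> I" for x
  proof (rule ccontr)
    assume "x \<noteq> 0"
    then have "\<iota> (\<bar>x\<bar> / 2) + \<iota> x \<in> M \<and> \<iota> (\<bar>x\<bar> / 2) - \<iota> x \<in> M"
      using that by (simp add: I_def)
    then have "0 \<le> \<bar>x\<bar> / 2 + x \<and> 0 \<le> \<bar>x\<bar> / 2 - x" by (simp only: iota_M flip: iota_add iota_diff)
    then show False using \<open>x \<noteq> 0\<close> by linarith
  qed
  have ex: "\<exists>x. a - \<iota> x \<in> I" if a: "a \<in> A" for a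
  proof -
    \<comment> \<open>The upper half of the cut that \<open>a\<close> makes in the reals under the
      order given by \<open>M\<close>. The archimedean property makes it nonempty and bounded below,
      so its infimum can serve as the value of \<open>a\<close>.\<close>
    let ?S = "{r. \<iota> r - a \<in> M}"
    obtain p where "\<iota> p + - a \<in> T" using archimedean minus_in a by blast
    then have p: "p \<in> ?S" using M'(1) by auto
    obtain q where q: "\<iota> q + a \<in> T" using archimedean a by blast
    have lower: "- q \<le> r" if "r \<in> ?S" for r
    proof -
      have "(\<iota> r - a) + (\<iota> q + a) \<in> M" using that q M'(1) by (intro M'(3)[of "\<iota> r - a"]) auto
      then have "\<iota> (r + q) \<in> M" by (simp add: iota_add)
      then show ?thesis by (simp add: iota_M)
    qed
    have bdd: "bdd_below ?S" using lower by (auto simp: bdd_below_def)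
    let ?x = "Inf ?S"
    have "\<iota> \<epsilon> + (a - \<iota> ?x) \<in> M \<and> \<iota> \<epsilon> - (a - \<iota> ?x) \<in> M" if e: "\<epsilon> > 0" for \<epsilon>
    proof
      \<comment> \<open>A real below the infimum is outside the cut, and totality of
        \<open>M\<close> turns this into membership of the negative.\<close>
      have "?x - \<epsilon> \<notin> ?S" using cInf_lower[OF _ bdd, of "?x - \<epsilon>"] e by auto
      then have "- (\<iota> (?x - \<epsilon>) - a) \<in> M"
        using maximal_module_total[OF M max diff_in[OF iota_in a]] by blast
      then show "\<iota> \<epsilon> + (a - \<iota> ?x) \<in> M" by (simp add: iota_diff algebra_simps)
      obtain r where r: "r \<in> ?S" "r < ?x + \<epsilon>"
        using cInf_lessD[of ?S "?x + \<epsilon>"] p e by auto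
      have "(\<iota> r - a) + \<iota> (?x + \<epsilon> - r) \<in> M" using r by (intro M'(3)[of "\<iota> r - a"]) (auto simp: iota_M)
      then show "\<iota> \<epsilon> - (a - \<iota> ?x) \<in> M" by (simp add: iota_diff iota_add algebra_simps)
    qed
    then show ?thesis using diff_in[OF a iota_in] by (auto simp: I_def)
  qed
  \<comment> \<open>The choice is unique on \<open>A\<close>, since by \<open>I_iota\<close> no
    nonzero scalar lies in \<open>I\<close>.\<close>
  define \<alpha> where "\<alpha> a = (SOME x. a - \<iota> x \<in> I)" for a
  have \<alpha>: "a - \<iota> (\<alpha> a) \<in> I" if "a \<in> A" for a
    unfolding \<alpha>_def using ex[OF that] by (rule someI_ex)
  have \<alpha>_eq: "\<alpha> a = x" if "a \<in> A" "a - \<iota> x \<in> I" for a x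
  proof -
    have "(a - \<iota> x) + - (a - \<iota> (\<alpha> a)) \<in> I" using that \<alpha> by (intro I_add I_minus)
    then have "\<iota> (\<alpha> a - x) \<in> I" by (simp add: iota_diff)
    then show ?thesis using I_iota by fastforce
  qed
  have "real_character \<alpha>"
    unfolding real_character_def
  proof (intro conjI ballI allI)
    fix a b assume a: "a \<in> A" and b: "b \<in> A"
    have "(a - \<iota> (\<alpha> a)) + (b - \<iota> (\<alpha> b)) \<in> I" using \<alpha> a b by (intro I_add)
    then show "\<alpha> (a + b) = \<alpha> a + \<alpha> b"
      using a b by (intro \<alpha>_eq add_in) (simp_all add: iota_add algebra_simps)
    have "a * (b - \<iota> (\<alpha> b)) + \<iota> (\<alpha> b) * (a - \<iota> (\<alpha> a)) \<in> I"
      using \<alpha> a b iota_in by (intro I_add I_mult)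
    then show "\<alpha> (a * b) = \<alpha> a * \<alpha> b"
      using a b by (intro \<alpha>_eq mult_in) (simp_all add: iota_mult algebra_simps)
  next
    fix r show "\<alpha> (\<iota> r) = r" using iota_in I_zero by (intro \<alpha>_eq) simp_all
  qed
  moreover have "0 \<le> \<alpha> a" if a: "a \<in> M" for a
  proof (rule ccontr)
    assume neg: "\<not> 0 \<le> \<alpha> a"
    \<comment> \<open>With the tolerance \<open>- \<alpha> a / 2\<close>, adding \<open>a\<close>
      leaves the negative scalar \<open>\<alpha> a / 2\<close> in \<open>M\<close>.\<close>
    then have "\<iota> (- (\<alpha> a / 2)) - (a - \<iota> (\<alpha> a)) \<in> M"
      using \<alpha>[of a] a M'(2) by (auto simp: I_def)
    then have "\<iota> (- (\<alpha> a / 2)) - (a - \<iota> (\<alpha> a)) + a \<in> M" using a by (rule M'(3))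
    then have "\<iota> (- (\<alpha> a / 2) + \<alpha> a) \<in> M" unfolding iota_add by simp
    with neg show False unfolding iota_M by simp
  qed
  ultimately show ?thesis by blast
qed

text \<open>A character that is not positive at \<open>f\<close> exists unless \<open>f t = 1 + s\<close> with \<open>s, t \<in> T\<close>. In that case
  choose \<open>n - t \<in> T\<close>: then \<open>n (f + r) - 1 = (n - t) (f + r) + s + r t\<close> lowers a bound
  \<open>f + r \<in> T\<close> with \<open>r \<ge> 0\<close> by the fixed amount \<open>1 / n\<close>.\<close>

theorem archimedean_positivstellensatz:
  assumes f: "f \<in> A"
    and pos: "\<And>\<alpha>. real_character \<alpha> \<Longrightarrow> (\<forall>t\<in>T. 0 \<le> \<alpha> t) \<Longrightarrow> 0 < \<alpha> f"
  shows "f \<in> T"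
proof -
  have zero: "0 \<in> T" and one: "1 \<in> T"
    using T_iota[of 0] T_iota[of 1] by (simp_all add: iota_0 iota_1)
  \<comment> \<open>The module generated by \<open>T\<close> and \<open>- f\<close>. Were it proper,
    a maximal module above it would give a character that is nonnegative on \<open>T\<close> with
    \<open>\<alpha> f \<le> 0\<close>.\<close>
  let ?M = "{s - f * t |s t. s \<in> T \<and> t \<in> T}"
  have "- 1 \<in> ?M"
  proof (rule ccontr)
    assume no: "- 1 \<notin> ?M"
    have sub: "T \<subseteq> ?M" using zero by force
    have "proper_module ?M"
      unfolding proper_module_def
    proof (intro conjI ballI)
      show "?M \<subseteq> A" using f T_subset by (auto intro!: diff_in mult_in)
    next
      fix x y assume "x \<in> ?M" "y \<in> ?M"
      then obtain s t s' t' where xy: "x = s - f * t" "y = s' - f * t'"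
        and "s \<in> T" "t \<in> T" "s' \<in> T" "t' \<in> T" by blast
      moreover have "x + y = (s + s') - f * (t + t')" by (simp add: xy algebra_simps)
      ultimately show "x + y \<in> ?M" using T_add by blast
    next
      fix u x assume "u \<in> T" "x \<in> ?M"
      then obtain s t where x: "x = s - f * t" and "s \<in> T" "t \<in> T" by blast
      moreover have "u * x = u * s - f * (u * t)" by (simp add: x algebra_simps)
      ultimately show "u * x \<in> ?M" using \<open>u \<in> T\<close> T_mult by blast
    qed (fact sub, fact no)
    then obtain M where M: "proper_module M" "?M \<subseteq> M" "\<And>X. proper_module X \<Longrightarrow> M \<subseteq> X \<Longrightarrow> X = M"
      by (rule maximal_proper_module) (rule that)
    obtain \<alpha> where \<alpha>: "real_character \<alpha>" "\<forall>a\<in>M. 0 \<le> \<alpha> a"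
      using character_of_maximal_module[OF M(1,3)] by blast
    have "- f \<in> ?M" using zero one by force
    then have "0 \<le> \<alpha> (- f)" using M(2) \<alpha>(2) by blast
    then have "\<alpha> f \<le> 0" using real_character_minus[OF \<alpha>(1) f] by simp
    moreover have "0 < \<alpha> f" using \<alpha> sub M(2) by (intro pos) blast+
    ultimately show False by simp
  qed
  then obtain s t where st: "s \<in> T" "t \<in> T" "- 1 = s - f * t" by blast
  obtain n0 where n0: "n0 \<ge> 0" "\<iota> n0 + - t \<in> T"
    using archimedean_nonneg[of "- t"] st(2) T_subset minus_in by blast
  \<comment> \<open>Adding 1 secures \<open>n > 0\<close>, so that \<open>1 / n\<close> is a genuine
    step length.\<close>
  define n where "n = n0 + 1"
  have n: "n > 0" "\<iota> n - t \<in> T"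
    using n0 T_add[OF T_iota[of 1] n0(2)] by (simp_all add: n_def iota_add algebra_simps)
  have step: "f + \<iota> (r - 1 / n) \<in> T" if "r \<ge> 0" "f + \<iota> r \<in> T" for r
  proof -
    have "(\<iota> n - t) * (f + \<iota> r) + (s + \<iota> r * t) \<in> T"
      by (rule T_add[OF T_mult[OF n(2) that(2)] T_add[OF st(1) T_mult[OF T_iota[OF that(1)] st(2)]]])
    also have "(\<iota> n - t) * (f + \<iota> r) + (s + \<iota> r * t) = \<iota> n * f + \<iota> n * \<iota> r + (s - f * t)"
      by (simp add: algebra_simps)
    also have "\<dots> = \<iota> n * f + \<iota> n * \<iota> r - 1" by (simp flip: st(3))
    finally have "\<iota> (1 / n) * (\<iota> n * f + \<iota> n * \<iota> r - 1) \<in> T" using n(1) by (intro T_mult T_iota) auto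
    also have "\<iota> (1 / n) * (\<iota> n * f + \<iota> n * \<iota> r - 1) = \<iota> (1 / n * n) * (f + \<iota> r) - \<iota> (1 / n)"
      unfolding iota_mult by (simp add: algebra_simps)
    also have "\<dots> = f + \<iota> (r - 1 / n)" using n(1) by (simp add: iota_1 iota_diff algebra_simps)
    finally show ?thesis .
  qed
  \<comment> \<open>\<open>step\<close> requires \<open>r \<ge> 0\<close>; once \<open>r\<close> is
    at most 0, adding the nonnegative scalar \<open>- r\<close> finishes. At most \<open>k\<close>
    steps of length \<open>1 / n\<close> lead there.\<close>
  have descent: "f \<in> T" if "f + \<iota> r \<in> T" "r \<le> real k / n" for r k
    using that
  proof (induction k arbitrary: r)
    case 0
    then have "f + \<iota> r + \<iota> (- r) \<in> T" by (intro T_add[of "f + \<iota> r"] T_iota) auto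
    then show ?case by (simp add: iota_minus)
  next
    case (Suc k)
    show ?case
    proof (cases "r \<ge> 0")
      case True
      have "r - 1 / n \<le> real k / n" using Suc.prems(2) by (simp add: add_divide_distrib)
      then show ?thesis using Suc.IH step[OF True Suc.prems(1)] by blast
    next
      case False
      then have "f + \<iota> r + \<iota> (- r) \<in> T" using Suc.prems by (intro T_add[of "f + \<iota> r"] T_iota) auto
      then show ?thesis by (simp add: iota_minus)
    qed
  qed
  obtain r where r: "\<iota> r + f \<in> T" using archimedean f by blast
  obtain k :: nat where "r * n \<le> real k" using real_arch_simple by blast
  then have "r \<le> real k / n" using n(1) by (simp add: field_simps)
  with descent[of r k] r show ?thesis by (simp add: add.commute)
qed

end

section \<open>Closures of sums of powers in seminormed algebras\<close>

text \<open>Only coefficients of index at most \<open>i\<close> of the factors enter coefficient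
  \<open>i\<close> of a product.\<close>

lemma fps_cutoff_power_nth:
  assumes "i < n"
  shows "fps_nth (fps_cutoff n F ^ m) i = fps_nth (F ^ m :: 'a::comm_ring_1 fps) i"
  using assms
proof (induction m arbitrary: i)
  case (Suc m)
  then show ?case by (auto simp: fps_mult_nth intro!: sum.cong)
qed simp

text \<open>The method of majorants: the triangle inequality in the convolution formula, by
  induction on \<open>m\<close>.\<close>

lemma abs_fps_power_nth_le:
  fixes F G :: "real fps"
  assumes "\<And>i. \<bar>fps_nth F i\<bar> \<le> fps_nth G i"
  shows "\<bar>fps_nth (F ^ m) i\<bar> \<le> fps_nth (G ^ m) i"
proof (induction m arbitrary: i)
  case (Suc m)
  have "\<bar>fps_nth (F ^ Suc m) i\<bar> \<le> (\<Sum>j=0..i. \<bar>fps_nth F j * fps_nth (F ^ m) (i - j)\<bar>)"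
    by (simp add: fps_mult_nth sum_abs)
  also have "\<dots> \<le> (\<Sum>j=0..i. fps_nth G j * fps_nth (G ^ m) (i - j))"
    unfolding abs_mult
    by (intro sum_mono mult_mono assms Suc) (auto intro: order_trans[OF abs_ge_zero assms])
  finally show ?case by (simp add: fps_mult_nth)
qed simp

text \<open>The approximants are the truncations of the binomial series of \<open>(1 + X) powr (1 / m)\<close>. Truncating
  at degree \<open>n\<close> does not affect the coefficients of the \<open>m\<close>-th power below \<open>n\<close>, and the others are
  dominated by a tail of the \<open>m\<close>-th power of the series of absolute values.\<close>

lemma approximate_root_one_plus_X:
  fixes r :: real
  assumes r: "0 \<le> r" "r < 1" and m: "m \<ge> 1" and e: "0 < \<epsilon>"
  shows "\<exists>p::real poly. (\<Sum>i\<le>degree (p ^ m - [:1, 1:]). \<bar>coeff (p ^ m - [:1, 1:]) i\<bar> * r ^ i) < \<epsilon>"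
proof -
  define F :: "real fps" where "F = fps_binomial (1 / real m)"
  define G :: "real fps" where "G = Abs_fps (\<lambda>n. \<bar>fps_nth F n\<bar>)"
  define c where "c i = fps_nth (G ^ m) i * r ^ i" for i
  have Fm: "F ^ m = 1 + fps_X"
    using m by (simp add: F_def fps_binomial_power fps_binomial_1)
  \<comment> \<open>The radius depends only on the moduli of the coefficients, so \<open>G\<close>,
    and hence \<open>G ^ m\<close>, still converges at \<open>r < 1\<close>.\<close>
  have "fps_conv_radius G = fps_conv_radius F"
    unfolding fps_conv_radius_def G_def by (simp flip: real_norm_def)
  also have "\<dots> \<ge> 1" by (simp add: F_def fps_conv_radius_binomial)
  finally have "fps_conv_radius (G ^ m) \<ge> 1"
    using fps_conv_radius_power order_trans by blast
  then have "summable c"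
    unfolding c_def using r
    by (intro summable_in_conv_radius) (auto simp: fps_conv_radius_def intro: less_le_trans[rotated])
  have c0: "c i \<ge> 0" for i
    using abs_fps_power_nth_le[of F G m i] r by (simp add: c_def G_def)
  obtain N where N: "\<And>n. n \<ge> N \<Longrightarrow> norm (suminf (\<lambda>i. c (i + n))) < \<epsilon>"
    using suminf_exist_split[OF e \<open>summable c\<close>] by blast
  \<comment> \<open>At least 2, so that \<open>1 + X\<close> has no nonzero coefficient of index
    \<open>n\<close> or above.\<close>
  define n where "n = max N 2"
  define p where "p = truncate_fps n F"
  define q where "q = p ^ m - [:1, 1:]"
  have q: "coeff q i = fps_nth (fps_cutoff n F ^ m) i - fps_nth (1 + fps_X) i" for i
  proof -
    have "fps_of_poly q = fps_cutoff n F ^ m - (1 + fps_X)"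
      by (simp add: q_def p_def fps_of_poly_diff fps_of_poly_power fps_of_poly_pCons)
    then show ?thesis by (metis fps_of_poly_nth fps_sub_nth)
  qed
  have small: "coeff q i = 0" if "i < n" for i
    using fps_cutoff_power_nth[OF that, of F m] by (simp add: q Fm)
  have large: "\<bar>coeff q i\<bar> * r ^ i \<le> c i" if "i \<ge> n" for i
  proof -
    have "\<bar>coeff q i\<bar> \<le> fps_nth (G ^ m) i"
      using that abs_fps_power_nth_le[of "fps_cutoff n F" G m i]
      by (simp add: q n_def G_def fps_X_def)
    then show ?thesis unfolding c_def using r by (intro mult_right_mono) auto
  qed
  have "(\<Sum>i\<le>degree q. \<bar>coeff q i\<bar> * r ^ i) \<le> (\<Sum>i<degree q + n + 1. \<bar>coeff q i\<bar> * r ^ i)"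
    using r by (intro sum_mono2) auto
  also have "\<dots> = (\<Sum>i\<in>{n..<degree q + n + 1}. \<bar>coeff q i\<bar> * r ^ i)"
    using small by (intro sum.mono_neutral_right) auto
  also have "\<dots> \<le> (\<Sum>i\<in>{n..<degree q + n + 1}. c i)"
    using large by (intro sum_mono) auto
  also have "\<dots> = (\<Sum>i<degree q + 1. c (i + n))"
    using sum.shift_bounds_nat_ivl[of c 0 n "degree q + 1"] by (simp add: atLeast0LessThan add_ac)
  also have "\<dots> \<le> suminf (\<lambda>i. c (i + n))"
    using \<open>summable c\<close> c0 by (intro sum_le_suminf) (auto simp: summable_iff_shift)
  also have "\<dots> < \<epsilon>" using N[of n] by (simp add: n_def)
  finally show ?thesis unfolding q_def by blast
qed

section \<open>Approximate roots in a seminormed algebra\<close>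

locale seminormed_real_algebra = real_subalgebra A \<iota>
  for A :: "'r::comm_ring_1 set" and \<iota> :: "real \<Rightarrow> 'r" +
  fixes N :: "'r \<Rightarrow> real"
  assumes N_add: "N (x + y) \<le> N x + N y"
    and N_mult: "N (x * y) \<le> N x * N y"
    and N_scale: "N (\<iota> c * x) = \<bar>c\<bar> * N x"
begin

lemma N_zero: "N 0 = 0"
  using N_scale[of 0 0] by simp

lemma N_minus: "N (- x) = N x"
  using N_scale[of "-1" x] by (simp add: iota_minus iota_1)

lemma N_nonneg: "0 \<le> N x"
  using N_add[of x "- x"] by (simp add: N_zero N_minus)

lemma N_sum: "N (\<Sum>i\<in>I. f i) \<le> (\<Sum>i\<in>I. N (f i))"
proof (induction I rule: infinite_finite_induct)
  case (insert x F)
  then show ?case using N_add[of "f x" "sum f F"] by simp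
qed (simp_all add: N_zero)

text \<open>\<open>N 1\<close> is not normalised: for the \<open>\<phi>\<close>-seminorm it is
  \<open>\<phi> 0\<close>, which may exceed 1. The factor \<open>N 1\<close> accounts for the case
  \<open>n = 0\<close>.\<close>

lemma N_power: "N (x ^ n) \<le> N 1 * N x ^ n"
proof (induction n)
  case (Suc n)
  have "N (x ^ Suc n) \<le> N x * N (x ^ n)" using N_mult by simp
  also have "\<dots> \<le> N x * (N 1 * N x ^ n)" using Suc N_nonneg by (intro mult_left_mono)
  finally show ?case by (simp add: mult_ac)
qed simp

lemma map_poly_iota_mult: "map_poly \<iota> (p * q) = map_poly \<iota> p * map_poly \<iota> q"
  by (rule poly_eqI) (simp add: coeff_map_poly iota_0 coeff_mult iota_sum iota_mult)

lemma map_poly_iota_power: "map_poly \<iota> (p ^ n) = map_poly \<iota> p ^ n"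
  by (induction n) (simp_all add: map_poly_1 iota_1 map_poly_iota_mult)

lemma map_poly_iota_diff: "map_poly \<iota> (p - q) = map_poly \<iota> p - map_poly \<iota> q"
  by (rule poly_eqI) (simp add: coeff_map_poly iota_0 iota_diff)

lemma poly_map_poly_iota:
  "poly (map_poly \<iota> p) a = (\<Sum>i\<le>degree p. \<iota> (coeff p i) * a ^ i)"
proof -
  have "poly (map_poly \<iota> p) a = (\<Sum>i\<le>degree (map_poly \<iota> p). \<iota> (coeff p i) * a ^ i)"
    by (simp add: poly_altdef coeff_map_poly iota_0)
  also have "\<dots> = (\<Sum>i\<le>degree p. \<iota> (coeff p i) * a ^ i)"
  proof (rule sum.mono_neutral_left)
    show "{..degree (map_poly \<iota> p)} \<subseteq> {..degree p}" using map_poly_degree_leq[of \<iota> p] by (simp add: iota_0)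
    show "\<forall>i\<in>{..degree p} - {..degree (map_poly \<iota> p)}. \<iota> (coeff p i) * a ^ i = 0"
      using coeff_eq_0[of "map_poly \<iota> p"] by (auto simp: coeff_map_poly iota_0)
  qed simp
  finally show ?thesis .
qed

lemma poly_map_poly_iota_in: "a \<in> A \<Longrightarrow> poly (map_poly \<iota> p) a \<in> A"
  unfolding poly_map_poly_iota by (intro sum_in mult_in iota_in power_in)

text \<open>\<open>A\<close> need not be complete, so the binomial series cannot be summed in it.
  Substituting \<open>a\<close> into the polynomial approximants suffices, since the error is at
  most \<open>N 1\<close> times the weighted coefficient sum at \<open>N a\<close>.\<close>

lemma approximate_root_one_plus:
  assumes a: "a \<in> A" "N a < 1" and m: "m \<ge> 1" and e: "0 < \<epsilon>"
  shows "\<exists>g\<in>A. N (g ^ m - (1 + a)) < \<epsilon>"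
proof -
  \<comment> \<open>The factor \<open>N 1\<close> from \<open>N_power\<close> is compensated in
    advance; the added 1 guards against \<open>N 1 = 0\<close>.\<close>
  have d: "\<epsilon> / (N 1 + 1) > 0" using e N_nonneg[of 1] by simp
  obtain p :: "real poly"
    where p: "(\<Sum>i\<le>degree (p ^ m - [:1, 1:]). \<bar>coeff (p ^ m - [:1, 1:]) i\<bar> * N a ^ i) < \<epsilon> / (N 1 + 1)"
    using approximate_root_one_plus_X[OF N_nonneg a(2) m d] by blast
  define q where "q = p ^ m - [:1, 1:]"
  let ?g = "poly (map_poly \<iota> p) a"
  have "map_poly \<iota> [:1, 1:] = [:1, 1:]" by (simp add: map_poly_pCons iota_0 iota_1)
  then have "?g ^ m - (1 + a) = poly (map_poly \<iota> q) a"
    by (simp add: q_def map_poly_iota_diff map_poly_iota_power)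
  also have "N \<dots> \<le> (\<Sum>i\<le>degree q. \<bar>coeff q i\<bar> * (N 1 * N a ^ i))"
    unfolding poly_map_poly_iota
    by (rule order_trans[OF N_sum]) (auto simp: N_scale intro!: sum_mono mult_left_mono N_power)
  also have "\<dots> = N 1 * (\<Sum>i\<le>degree q. \<bar>coeff q i\<bar> * N a ^ i)"
    by (simp add: sum_distrib_left mult_ac)
  also have "\<dots> \<le> N 1 * (\<epsilon> / (N 1 + 1))"
    using p N_nonneg by (intro mult_left_mono) (auto simp: q_def)
  also have "\<dots> < \<epsilon>" using e N_nonneg[of 1] by (simp add: field_simps)
  finally show ?thesis using poly_map_poly_iota_in[OF a(1)] by blast
qed

section \<open>Power sums and their closures\<close>

definition power_sums :: "nat \<Rightarrow> 'r set" where
  "power_sums m = {(\<Sum>i<n. g i ^ m) | (n::nat) g. \<forall>i<n. g i \<in> A}"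

definition N_closure :: "'r set \<Rightarrow> 'r set" where
  "N_closure S = {f \<in> A. \<forall>\<epsilon>>0. \<exists>g\<in>S. N (g - f) < \<epsilon>}"

lemma N_closureD: "f \<in> N_closure S \<Longrightarrow> 0 < \<epsilon> \<Longrightarrow> \<exists>g\<in>S. N (g - f) < \<epsilon>"
  by (simp add: N_closure_def)

text \<open>Free choice of the finite index set lets sums be indexed by disjoint unions and products
  by Cartesian products.\<close>

lemma power_sums_finite:
  assumes "finite I" "\<And>i. i \<in> I \<Longrightarrow> g i \<in> A"
  shows "(\<Sum>i\<in>I. g i ^ m) \<in> power_sums m"
proof -
  obtain h where h: "bij_betw h {..<card I} I"
    using ex_bij_betw_nat_finite[OF assms(1)] by (auto simp: atLeast0LessThan)
  have "(\<Sum>i<card I. g (h i) ^ m) = (\<Sum>i\<in>I. g i ^ m)"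
    using h by (rule sum.reindex_bij_betw)
  then show ?thesis unfolding power_sums_def
    using h assms(2) by (auto dest!: bij_betwE intro!: exI[of _ "card I"] exI[of _ "\<lambda>i. g (h i)"])
qed

lemma power_sums_subset: "power_sums m \<subseteq> A"
  by (auto simp: power_sums_def intro!: sum_in power_in)

lemma power_in_power_sums: "a \<in> A \<Longrightarrow> a ^ m \<in> power_sums m"
  using power_sums_finite[of "{()}" "\<lambda>_. a" m] by simp

lemma power_sums_add:
  assumes "f \<in> power_sums m" "g \<in> power_sums m"
  shows "f + g \<in> power_sums m"
proof -
  obtain k u l v where f: "f = (\<Sum>i<k::nat. u i ^ m)" "\<forall>i<k. u i \<in> A"
    and g: "g = (\<Sum>i<l::nat. v i ^ m)" "\<forall>i<l. v i \<in> A"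
    using assms by (auto simp: power_sums_def)
  have "(\<Sum>i\<in>{..<k} <+> {..<l}. case_sum u v i ^ m) \<in> power_sums m"
    using f g by (intro power_sums_finite) auto
  then show ?thesis by (simp add: sum.Plus f g)
qed

lemma power_sums_mult:
  assumes "f \<in> power_sums m" "g \<in> power_sums m"
  shows "f * g \<in> power_sums m"
proof -
  obtain k u l v where f: "f = (\<Sum>i<k::nat. u i ^ m)" "\<forall>i<k. u i \<in> A"
    and g: "g = (\<Sum>i<l::nat. v i ^ m)" "\<forall>i<l. v i \<in> A"
    using assms by (auto simp: power_sums_def)
  have "(\<Sum>i\<in>{..<k} \<times> {..<l}. (u (fst i) * v (snd i)) ^ m) \<in> power_sums m"
    using f g by (intro power_sums_finite) (auto intro: mult_in)
  then show ?thesis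
    by (simp add: f g sum_product sum.cartesian_product power_mult_distrib case_prod_beta)
qed

lemma closure_power_sums_add:
  assumes f: "f \<in> N_closure (power_sums m)" and g: "g \<in> N_closure (power_sums m)"
  shows "f + g \<in> N_closure (power_sums m)"
proof -
  have "\<exists>h\<in>power_sums m. N (h - (f + g)) < \<epsilon>" if e: "\<epsilon> > 0" for \<epsilon>
  proof -
    obtain f' g' where "f' \<in> power_sums m" "N (f' - f) < \<epsilon> / 2" "g' \<in> power_sums m" "N (g' - g) < \<epsilon> / 2"
      using N_closureD[OF f half_gt_zero[OF e]] N_closureD[OF g half_gt_zero[OF e]] by blast
    moreover have "N (f' + g' - (f + g)) \<le> N (f' - f) + N (g' - g)"
      using N_add[of "f' - f" "g' - g"] by (simp add: algebra_simps)
    ultimately show ?thesis by (intro bexI[of _ "f' + g'"] power_sums_add) auto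
  qed
  then show ?thesis using f g by (auto simp: N_closure_def add_in)
qed

lemma closure_power_sums_mult:
  assumes f: "f \<in> N_closure (power_sums m)" and g: "g \<in> N_closure (power_sums m)"
  shows "f * g \<in> N_closure (power_sums m)"
proof -
  have "\<exists>h\<in>power_sums m. N (h - f * g) < \<epsilon>" if e: "\<epsilon> > 0" for \<epsilon>
  proof -
    define K where "K = N f + N g + 2"
    have K: "K > 1" using N_nonneg[of f] N_nonneg[of g] by (simp add: K_def)
    define \<delta> where "\<delta> = min 1 (\<epsilon> / (2 * K))"
    have d: "\<delta> > 0" "\<delta> \<le> 1" "2 * K * \<delta> \<le> \<epsilon>"
      using e K by (auto simp: \<delta>_def min_def field_simps)
    obtain f' g' where f': "f' \<in> power_sums m" "N (f' - f) < \<delta>"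
      and g': "g' \<in> power_sums m" "N (g' - g) < \<delta>"
      using N_closureD[OF f d(1)] N_closureD[OF g d(1)] by blast
    have "N g' \<le> N (g' - g) + N g" using N_add[of "g' - g" g] by simp
    then have Ng: "N g' \<le> K" using g'(2) d(2) N_nonneg[of f] by (simp add: K_def)
    have Nf: "N f \<le> K" using N_nonneg[of g] by (simp add: K_def)
    have "N (f' * g' - f * g) = N ((f' - f) * g' + f * (g' - g))" by (simp add: algebra_simps)
    also have "\<dots> \<le> N (f' - f) * N g' + N f * N (g' - g)"
      by (intro order_trans[OF N_add] add_mono N_mult)
    also have "\<dots> \<le> N (f' - f) * K + K * N (g' - g)"
      using Ng Nf N_nonneg by (intro add_mono mult_left_mono mult_right_mono) auto
    also have "\<dots> < \<delta> * K + K * \<delta>"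
      using f' g' K by (intro add_strict_mono mult_strict_right_mono mult_strict_left_mono) auto
    also have "\<dots> \<le> \<epsilon>" using d(3) by simp
    finally show ?thesis using f' g' power_sums_mult by blast
  qed
  then show ?thesis using f g by (auto simp: N_closure_def mult_in)
qed

lemma power_sums_subset_closure: "power_sums m \<subseteq> N_closure (power_sums m)"
  using power_sums_subset[of m] by (force simp: N_closure_def N_zero)

lemma iota_in_closure:
  assumes "0 \<le> r" "m \<ge> 1"
  shows "\<iota> r \<in> N_closure (power_sums m)"
proof -
  have "\<iota> r = \<iota> (root m r) ^ m" using assms by (simp flip: iota_power)
  then show ?thesis using power_in_power_sums[OF iota_in, of "root m r" m] power_sums_subset_closure by auto
qed

text \<open>Dividing by \<open>r\<close> reduces to \<open>1 + b\<close> with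
  \<open>N b < 1\<close>, a limit of single \<open>m\<close>-th powers. This gives both the
  archimedean property and the bound on characters.\<close>

lemma iota_plus_in_closure:
  assumes a: "a \<in> A" "N a < r" and m: "m \<ge> 1"
  shows "\<iota> r + a \<in> N_closure (power_sums m)"
proof -
  have r: "r > 0" using a N_nonneg[of a] by simp
  let ?b = "\<iota> (1 / r) * a"
  have "?b \<in> A" using a iota_in mult_in by blast
  moreover have "N ?b < 1" using a r by (simp add: N_scale)
  ultimately have "1 + ?b \<in> N_closure (power_sums m)"
    using approximate_root_one_plus[of ?b m] m power_in_power_sums add_in one_in
    by (fastforce simp: N_closure_def)
  then have "\<iota> r * (1 + ?b) \<in> N_closure (power_sums m)"
    using r m by (intro closure_power_sums_mult iota_in_closure) auto
  moreover have "\<iota> r * (1 + ?b) = \<iota> r + \<iota> (r * (1 / r)) * a"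
    unfolding iota_mult by (simp add: algebra_simps)
  ultimately show ?thesis using r by (simp add: iota_1)
qed

lemma archimedean_semiring_closure:
  assumes "m \<ge> 1"
  shows "archimedean_semiring A \<iota> (N_closure (power_sums m))"
proof unfold_locales
  show "N_closure (power_sums m) \<subseteq> A" by (auto simp: N_closure_def)
  show "\<exists>r. \<iota> r + a \<in> N_closure (power_sums m)" if "a \<in> A" for a
    using iota_plus_in_closure[OF that _ assms, of "N a + 1"] by auto
qed (use assms closure_power_sums_add closure_power_sums_mult iota_in_closure in auto)

text \<open>The Positivstellensatz asks for strict positivity, so it is applied to
  \<open>f + \<delta>\<close>, and the closure absorbs \<open>\<delta>\<close>.\<close>

theorem closure_power_sums_contains:
  assumes m: "m \<ge> 1" and f: "f \<in> A"
    and pos: "\<And>\<alpha>. real_character \<alpha> \<Longrightarrow> (\<forall>a\<in>A. \<bar>\<alpha> a\<bar> \<le> N a) \<Longrightarrow> 0 \<le> \<alpha> f"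
  shows "f \<in> N_closure (power_sums m)"
proof -
  interpret archimedean_semiring A \<iota> "N_closure (power_sums m)"
    by (rule archimedean_semiring_closure[OF m])
  have shifted: "f + \<iota> \<delta> \<in> N_closure (power_sums m)" if d: "\<delta> > 0" for \<delta>
  proof (rule archimedean_positivstellensatz)
    show "f + \<iota> \<delta> \<in> A" using f iota_in add_in by blast
    fix \<alpha> assume \<alpha>: "real_character \<alpha>" and T: "\<forall>t\<in>N_closure (power_sums m). 0 \<le> \<alpha> t"
    \<comment> \<open>\<open>N a + e + a\<close> lies in the closure for every \<open>e > 0\<close>,
      so \<open>\<alpha>\<close> is nonnegative there; using \<open>- a\<close> as well bounds the
      absolute value.\<close>
    have below: "- N a \<le> \<alpha> a" if a: "a \<in> A" for a
    proof (rule field_le_epsilon)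
      fix e :: real assume "e > 0"
      then have "0 \<le> \<alpha> (\<iota> (N a + e) + a)"
        using T iota_plus_in_closure[OF a _ m, of "N a + e"] by simp
      also have "\<dots> = N a + e + \<alpha> a" using \<alpha> a iota_in by (simp add: real_character_def)
      finally show "- N a \<le> \<alpha> a + e" by simp
    qed
    have "\<bar>\<alpha> a\<bar> \<le> N a" if a: "a \<in> A" for a
      using below[OF a] below[OF minus_in[OF a]] real_character_minus[OF \<alpha> a] N_minus[of a] by simp
    then have "0 \<le> \<alpha> f" using \<alpha> by (intro pos) auto
    then show "0 < \<alpha> (f + \<iota> \<delta>)" using \<alpha> f iota_in d by (simp add: real_character_def)
  qed
  have "\<exists>g\<in>power_sums m. N (g - f) < \<epsilon>" if e: "\<epsilon> > 0" for \<epsilon>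
  proof -
    define \<delta> where "\<delta> = \<epsilon> / (2 * (N 1 + 1))"
    have d: "\<delta> > 0" "\<delta> * N 1 < \<epsilon> / 2"
      using e N_nonneg[of 1] by (auto simp: \<delta>_def field_simps)
    obtain g where g: "g \<in> power_sums m" "N (g - (f + \<iota> \<delta>)) < \<epsilon> / 2"
      using N_closureD[OF shifted[OF d(1)] half_gt_zero[OF e]] by blast
    have "N (g - f) \<le> N (g - (f + \<iota> \<delta>)) + N (\<iota> \<delta> * 1)"
      using N_add[of "g - (f + \<iota> \<delta>)" "\<iota> \<delta>"] by simp
    then have "N (g - f) < \<epsilon>" using g d by (simp add: N_scale del: mult_1_right)
    with g(1) show ?thesis by blast
  qed
  then show ?thesis using f by (auto simp: N_closure_def)
qed

end

section \<open>The semigroup algebra\<close>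

lemma sum_single_keys: "(\<Sum>s\<in>Poly_Mapping.keys f. Poly_Mapping.single s (Poly_Mapping.lookup f s)) = f"
  by (rule poly_mapping_eqI)
    (auto simp: lookup_sum lookup_single when_def in_keys_iff sum.delta)

text \<open>Expansion into monomials reduces the product rules for evaluation, seminorm and
  involution to rules on the semigroup.\<close>

lemma mult_eq_sum_single:
  fixes f g :: "'a::comm_monoid_add \<Rightarrow>\<^sub>0 'b::comm_semiring_1"
  shows "f * g = (\<Sum>s\<in>Poly_Mapping.keys f. \<Sum>t\<in>Poly_Mapping.keys g.
    Poly_Mapping.single (s + t) (Poly_Mapping.lookup f s * Poly_Mapping.lookup g t))"
proof -
  have "f * g = (\<Sum>s\<in>Poly_Mapping.keys f. Poly_Mapping.single s (Poly_Mapping.lookup f s)) *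
      (\<Sum>t\<in>Poly_Mapping.keys g. Poly_Mapping.single t (Poly_Mapping.lookup g t))"
    by (simp only: sum_single_keys)
  then show ?thesis by (simp add: sum_product mult_single)
qed

lemma extend_diff: "extend \<alpha> (f - g) = extend \<alpha> f - extend \<alpha> g"
  using extend_add[of \<alpha> "f - g" g] by simp

lemma extend_mult:
  assumes "\<alpha> \<in> semicharacters star"
  shows "extend \<alpha> (f * g) = extend \<alpha> f * extend \<alpha> g"
  using assms
  by (simp add: mult_eq_sum_single[of f g] extend_sum extend_single semicharacters_def)
    (simp add: extend_def sum_product mult_ac)

lemma extend_power:
  assumes "\<alpha> \<in> semicharacters star"
  shows "extend \<alpha> (f ^ n) = extend \<alpha> f ^ n"
proof (induction n)
  case 0
  show ?case using assms extend_single[of \<alpha> 0 1] by (simp add: semicharacters_def)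
next
  case (Suc n)
  then show ?case using assms by (simp add: extend_mult)
qed

lemma phi_seminorm_superset:
  assumes "finite B" "Poly_Mapping.keys f \<subseteq> B"
  shows "phi_seminorm \<phi> f = (\<Sum>s\<in>B. cmod (Poly_Mapping.lookup f s) * \<phi> s)"
  unfolding phi_seminorm_def using assms
  by (intro sum.mono_neutral_left) (auto simp: in_keys_iff)

lemma phi_seminorm_single: "phi_seminorm \<phi> (Poly_Mapping.single s c) = cmod c * \<phi> s"
  by (simp add: phi_seminorm_def)

lemma phi_seminorm_add:
  assumes "\<And>s. 0 \<le> \<phi> s"
  shows "phi_seminorm \<phi> (f + g) \<le> phi_seminorm \<phi> f + phi_seminorm \<phi> g"
proof -
  let ?B = "Poly_Mapping.keys f \<union> Poly_Mapping.keys g"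
  have "phi_seminorm \<phi> (f + g) = (\<Sum>s\<in>?B. cmod (Poly_Mapping.lookup f s + Poly_Mapping.lookup g s) * \<phi> s)"
    using phi_seminorm_superset[of ?B "f + g" \<phi>] Poly_Mapping.keys_add[of f g] by (simp add: lookup_add)
  also have "\<dots> \<le> (\<Sum>s\<in>?B. cmod (Poly_Mapping.lookup f s) * \<phi> s + cmod (Poly_Mapping.lookup g s) * \<phi> s)"
    unfolding distrib_right[symmetric]
    by (intro sum_mono mult_right_mono norm_triangle_ineq assms)
  also have "\<dots> = phi_seminorm \<phi> f + phi_seminorm \<phi> g"
    using phi_seminorm_superset[of ?B f \<phi>] phi_seminorm_superset[of ?B g \<phi>] by (simp add: sum.distrib)
  finally show ?thesis .
qed

lemma phi_seminorm_sum:
  assumes "\<And>s. 0 \<le> \<phi> s"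
  shows "phi_seminorm \<phi> (\<Sum>i\<in>I. f i) \<le> (\<Sum>i\<in>I. phi_seminorm \<phi> (f i))"
proof (induction I rule: infinite_finite_induct)
  case (insert x F)
  then show ?case using phi_seminorm_add[of \<phi> "f x" "sum f F"] assms by simp
qed (simp_all add: phi_seminorm_def)

lemma phi_seminorm_mult:
  assumes "absolute_value star \<phi>"
  shows "phi_seminorm \<phi> (f * g) \<le> phi_seminorm \<phi> f * phi_seminorm \<phi> g"
proof -
  have nonneg: "0 \<le> \<phi> s" and sub: "\<phi> (s + t) \<le> \<phi> s * \<phi> t" for s t
    using assms by (auto simp: absolute_value_def)
  let ?f = "Poly_Mapping.lookup f" and ?g = "Poly_Mapping.lookup g"
  have "phi_seminorm \<phi> (f * g) \<le> (\<Sum>s\<in>Poly_Mapping.keys f. \<Sum>t\<in>Poly_Mapping.keys g.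
      phi_seminorm \<phi> (Poly_Mapping.single (s + t) (?f s * ?g t)))"
    unfolding mult_eq_sum_single[of f g]
    by (intro order_trans[OF phi_seminorm_sum] sum_mono phi_seminorm_sum nonneg)
  also have "\<dots> \<le> (\<Sum>s\<in>Poly_Mapping.keys f. \<Sum>t\<in>Poly_Mapping.keys g.
      cmod (?f s) * cmod (?g t) * (\<phi> s * \<phi> t))"
    unfolding phi_seminorm_single norm_mult
    by (intro sum_mono mult_left_mono sub) auto
  also have "\<dots> = phi_seminorm \<phi> f * phi_seminorm \<phi> g"
    unfolding phi_seminorm_def sum_product by (simp add: mult_ac)
  finally show ?thesis .
qed

text \<open>Submultiplicativity would only give the factor \<open>cmod c * \<phi> 0\<close>, which
  is too large when \<open>\<phi> 0 > 1\<close>; hence the computation on coefficients.\<close>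

lemma phi_seminorm_scale:
  "phi_seminorm \<phi> (Poly_Mapping.single 0 c * f) = cmod c * phi_seminorm \<phi> f"
proof -
  have l: "Poly_Mapping.lookup (Poly_Mapping.single 0 c * f) s = c * Poly_Mapping.lookup f s" for s
    by (simp flip: mult_map_scale_conv_mult add: map.rep_eq when_def)
  then have "Poly_Mapping.keys (Poly_Mapping.single 0 c * f) \<subseteq> Poly_Mapping.keys f"
    by (auto simp: in_keys_iff)
  then have "phi_seminorm \<phi> (Poly_Mapping.single 0 c * f) =
      (\<Sum>s\<in>Poly_Mapping.keys f. cmod (c * Poly_Mapping.lookup f s) * \<phi> s)"
    using phi_seminorm_superset[of "Poly_Mapping.keys f" "Poly_Mapping.single 0 c * f" \<phi>]
    by (simp only: l finite_keys)
  then show ?thesis by (simp add: phi_seminorm_def norm_mult sum_distrib_left mult_ac)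
qed

text \<open>Evaluation at a point of \<open>K_phi\<close> is thus continuous, so nonnegativity
  passes to closures.\<close>

lemma cmod_extend_le:
  assumes "\<alpha> \<in> K_phi star \<phi>"
  shows "cmod (extend \<alpha> f) \<le> phi_seminorm \<phi> f"
  unfolding extend_def phi_seminorm_def using assms
  by (intro sum_norm_le) (auto simp: K_phi_def norm_mult intro: mult_left_mono)

section \<open>The involution on the semigroup algebra\<close>

lemma algebra_involution_single:
  "algebra_involution star (Poly_Mapping.single s c) = Poly_Mapping.single (star s) (cnj c)"
  by (simp add: algebra_involution_def)

lemma algebra_involution_add:
  "algebra_involution star (f + g) = algebra_involution star f + algebra_involution star g"
  unfolding algebra_involution_def
  by (rule setsum_keys_plus_distrib) (simp_all add: single_add)

lemma algebra_involution_zero: "algebra_involution star 0 = 0"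
  by (simp add: algebra_involution_def)

lemma algebra_involution_sum:
  "algebra_involution star (\<Sum>i\<in>I. f i) = (\<Sum>i\<in>I. algebra_involution star (f i))"
  by (induction I rule: infinite_finite_induct)
    (simp_all add: algebra_involution_add algebra_involution_zero)

lemma algebra_involution_diff:
  "algebra_involution star (f - g) = algebra_involution star f - algebra_involution star g"
  using algebra_involution_add[of star "f - g" g] by simp

lemma algebra_involution_mult:
  assumes "semigroup_involution star"
  shows "algebra_involution star (f * g) = algebra_involution star f * algebra_involution star g"
proof -
  have "algebra_involution star (f * g) = (\<Sum>s\<in>Poly_Mapping.keys f. \<Sum>t\<in>Poly_Mapping.keys g.
      Poly_Mapping.single (star s) (cnj (Poly_Mapping.lookup f s)) *
      Poly_Mapping.single (star t) (cnj (Poly_Mapping.lookup g t)))"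
    using assms unfolding mult_eq_sum_single[of f g]
    by (simp add: algebra_involution_sum algebra_involution_single mult_single semigroup_involution_def)
  then show ?thesis by (simp add: algebra_involution_def sum_product)
qed

lemma algebra_involution_involutive:
  assumes "semigroup_involution star"
  shows "algebra_involution star (algebra_involution star f) = f"
  using assms unfolding algebra_involution_def[of star f]
  by (simp add: algebra_involution_sum algebra_involution_single semigroup_involution_def sum_single_keys)

section \<open>The real algebra of symmetric elements and its characters\<close>

definition real_const :: "real \<Rightarrow> ('a::comm_monoid_add \<Rightarrow>\<^sub>0 complex)" where
  "real_const r = Poly_Mapping.single 0 (complex_of_real r)"

lemma seminormed_real_algebra_symmetric_elements:
  assumes star: "semigroup_involution star" and \<phi>: "absolute_value star \<phi>"
  shows "seminormed_real_algebra (symmetric_elements star) real_const (phi_seminorm \<phi>)"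
proof unfold_locales
  show "phi_seminorm \<phi> (f + g) \<le> phi_seminorm \<phi> f + phi_seminorm \<phi> g" for f g
    using \<phi> by (intro phi_seminorm_add) (simp add: absolute_value_def)
  show "real_const r \<in> symmetric_elements star" for r
    using star by (simp add: symmetric_elements_def real_const_def algebra_involution_single semigroup_involution_def)
qed (use star in \<open>auto simp: real_const_def single_add mult_single symmetric_elements_def
       algebra_involution_add algebra_involution_mult phi_seminorm_mult[OF \<phi>] phi_seminorm_scale\<close>)

text \<open>Complexify \<open>\<alpha>\<close> along \<open>f = re f + \<i> im f\<close> with symmetric \<open>re f\<close> and \<open>im f\<close>. The bound at a semigroup
  element \<open>s\<close>, which need not be symmetric, comes from the symmetric element \<open>s s\<^sup>*\<close>.\<close>

lemma real_character_extends:
  assumes star: "semigroup_involution star" and \<phi>: "absolute_value star \<phi>"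
    and \<alpha>: "real_subalgebra.real_character (symmetric_elements star) real_const \<alpha>"
    and bound: "\<And>a. a \<in> symmetric_elements star \<Longrightarrow> \<bar>\<alpha> a\<bar> \<le> phi_seminorm \<phi> a"
  shows "\<exists>\<xi>\<in>K_phi star \<phi>. \<forall>f\<in>symmetric_elements star. extend \<xi> f = complex_of_real (\<alpha> f)"
proof -
  let ?A = "symmetric_elements star"
  let ?inv = "algebra_involution star"
  interpret seminormed_real_algebra ?A real_const "phi_seminorm \<phi>"
    by (rule seminormed_real_algebra_symmetric_elements[OF star \<phi>])
  \<comment> \<open>\<open>J\<close> and \<open>h\<close> are the imaginary unit and one half as
    elements of the algebra.\<close>
  define J :: "'a \<Rightarrow>\<^sub>0 complex" where "J = Poly_Mapping.single 0 \<i>"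
  define h :: "'a \<Rightarrow>\<^sub>0 complex" where "h = Poly_Mapping.single 0 (1 / 2)"
  have star0: "star 0 = 0" using star by (simp add: semigroup_involution_def)
  have JJ: "J * J = - 1" by (simp add: J_def mult_single single_uminus)
  have h2: "h + h = 1" by (simp add: h_def flip: single_add)
  have inv_J: "?inv J = - J" by (simp add: J_def algebra_involution_single star0 single_uminus)
  have inv_h: "?inv h = h" by (simp add: h_def algebra_involution_single star0)
  have sym: "?inv a = a" if "a \<in> ?A" for a using that by (simp add: symmetric_elements_def)
  define re where "re f = h * (f + ?inv f)" for f
  define im where "im f = h * (- J * (f - ?inv f))" for f
  have inv_minus: "?inv (- f) = - ?inv f" for f
    using algebra_involution_diff[of star 0 f] by (simp add: algebra_involution_zero)
  have re_in: "re f \<in> ?A" and im_in: "im f \<in> ?A" for f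
    by (simp_all add: re_def im_def symmetric_elements_def algebra_involution_mult[OF star]
        algebra_involution_add algebra_involution_diff algebra_involution_involutive[OF star]
        inv_minus inv_J inv_h algebra_simps)
  have re_eq: "re (a + J * b) = a" and im_eq: "im (a + J * b) = b" if "a \<in> ?A" "b \<in> ?A" for a b
  proof -
    have inv: "?inv (a + J * b) = a - J * b"
      using that by (simp add: algebra_involution_add algebra_involution_mult[OF star] inv_J sym)
    have "re (a + J * b) = (h + h) * a" by (simp add: re_def inv algebra_simps)
    then show "re (a + J * b) = a" by (simp add: h2)
    have "im (a + J * b) = (h + h) * (- (J * J) * b)" by (simp add: im_def inv algebra_simps)
    then show "im (a + J * b) = b" by (simp add: h2 JJ)
  qed
  have decompose: "f = re f + J * im f" for f
  proof -
    have "re f + J * im f = h * (f + ?inv f) + h * (- (J * J) * (f - ?inv f))"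
      by (simp add: re_def im_def algebra_simps)
    also have "\<dots> = (h + h) * f" unfolding JJ by (simp add: algebra_simps)
    finally show ?thesis by (simp add: h2)
  qed
  have \<alpha>_add: "\<alpha> (a + b) = \<alpha> a + \<alpha> b" and \<alpha>_mult: "\<alpha> (a * b) = \<alpha> a * \<alpha> b"
    if "a \<in> ?A" "b \<in> ?A" for a b
    using \<alpha> that by (auto simp: real_character_def)
  have \<alpha>_const: "\<alpha> (real_const r) = r" for r using \<alpha> by (simp add: real_character_def)
  have \<alpha>_diff: "\<alpha> (a - b) = \<alpha> a - \<alpha> b" if "a \<in> ?A" "b \<in> ?A" for a b
    using \<alpha>_add[of "a - b" b] that diff_in by simp
  define \<beta> where "\<beta> f = Complex (\<alpha> (re f)) (\<alpha> (im f))" for f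
  have \<beta>_eq: "\<beta> (a + J * b) = Complex (\<alpha> a) (\<alpha> b)" if "a \<in> ?A" "b \<in> ?A" for a b
    using that by (simp add: \<beta>_def re_eq im_eq)
  have \<beta>_add: "\<beta> (f + g) = \<beta> f + \<beta> g" for f g
  proof -
    have "f + g = (re f + re g) + J * (im f + im g)"
      using decompose[of f] decompose[of g] by (simp add: algebra_simps)
    then show ?thesis
      using \<beta>_eq[of "re f + re g" "im f + im g"] re_in im_in add_in
      by (simp add: \<beta>_def \<alpha>_add complex_eq_iff)
  qed
  have \<beta>_mult: "\<beta> (f * g) = \<beta> f * \<beta> g" for f g
  proof -
    have "f * g = (re f + J * im f) * (re g + J * im g)"
      using decompose[of f] decompose[of g] by simp
    also have "\<dots> = re f * re g + (J * J) * (im f * im g) + J * (re f * im g + im f * re g)"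
      by (simp add: algebra_simps)
    also have "\<dots> = (re f * re g - im f * im g) + J * (re f * im g + im f * re g)"
      by (simp add: JJ)
    finally show ?thesis
      using \<beta>_eq[of "re f * re g - im f * im g" "re f * im g + im f * re g"] re_in im_in
      by (simp add: \<beta>_def \<alpha>_add \<alpha>_mult \<alpha>_diff add_in mult_in diff_in complex_eq_iff)
  qed
  have \<beta>_inv: "\<beta> (?inv f) = cnj (\<beta> f)" for f
  proof -
    have "?inv f = ?inv (re f + J * im f)" using decompose[of f] by simp
    also have "\<dots> = re f + J * (0 - im f)"
      using re_in im_in
      by (simp add: algebra_involution_add algebra_involution_mult[OF star] inv_J sym)
    finally show ?thesis
      using \<beta>_eq[of "re f" "0 - im f"] re_in im_in minus_in real_character_minus[OF \<alpha>]
      by (simp add: \<beta>_def complex_eq_iff)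
  qed
  have \<alpha>_0: "\<alpha> 0 = 0" using \<alpha>_const[of 0] by (simp add: iota_0)
  have \<beta>_sym: "\<beta> a = complex_of_real (\<alpha> a)" if "a \<in> ?A" for a
    using \<beta>_eq[of a 0] that iota_in[of 0] by (simp add: iota_0 \<alpha>_0 complex_eq_iff)
  have \<beta>_const: "\<beta> (Poly_Mapping.single 0 c) = c" for c
  proof -
    have "Poly_Mapping.single 0 c = real_const (Re c) + J * real_const (Im c)"
      using complex_eq[of c] by (simp add: real_const_def J_def mult_single flip: single_add)
    then show ?thesis using \<beta>_eq[OF iota_in iota_in] by (simp add: \<alpha>_const)
  qed
  define \<xi> where "\<xi> s = \<beta> (Poly_Mapping.single s 1)" for s
  have \<xi>_semi: "\<xi> \<in> semicharacters star"
    unfolding semicharacters_def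
  proof (intro CollectI conjI allI)
    show "\<xi> 0 = 1" by (simp add: \<xi>_def \<beta>_const del: single_one)
    show "\<xi> (s + t) = \<xi> s * \<xi> t" for s t by (simp add: \<xi>_def mult_single flip: \<beta>_mult)
    show "\<xi> (star s) = cnj (\<xi> s)" for s
      by (simp add: \<xi>_def algebra_involution_single flip: \<beta>_inv)
  qed
  have "cmod (\<xi> s) \<le> \<phi> s" for s
  proof -
    let ?p = "Poly_Mapping.single (s + star s) (1::complex)"
    have p: "?p \<in> ?A"
      using star by (simp add: symmetric_elements_def algebra_involution_single semigroup_involution_def add.commute)
    have "complex_of_real ((cmod (\<xi> s))\<^sup>2) = \<xi> s * cnj (\<xi> s)" by (rule complex_norm_square)
    also have "\<dots> = \<beta> ?p" using \<xi>_semi by (simp add: semicharacters_def flip: \<xi>_def)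
    also have "\<dots> = complex_of_real (\<alpha> ?p)" by (rule \<beta>_sym[OF p])
    finally have "(cmod (\<xi> s))\<^sup>2 = \<alpha> ?p" by (simp only: of_real_eq_iff)
    also have "\<dots> \<le> \<phi> (s + star s)" using bound[OF p] by (simp add: phi_seminorm_single)
    also have "\<dots> \<le> \<phi> s * \<phi> (star s)" using \<phi> unfolding absolute_value_def by blast
    also have "\<dots> = (\<phi> s)\<^sup>2" using \<phi> by (simp add: absolute_value_def power2_eq_square)
    finally show ?thesis using \<phi> by (auto simp: absolute_value_def intro: power2_le_imp_le)
  qed
  then have K: "\<xi> \<in> K_phi star \<phi>" using \<xi>_semi by (simp add: K_phi_def)
  have extend: "extend \<xi> f = \<beta> f" for f
  proof -
    have \<beta>_0: "\<beta> 0 = 0" using \<beta>_const[of 0] by simp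
    have \<beta>_sum: "\<beta> (\<Sum>i\<in>I. g i) = (\<Sum>i\<in>I. \<beta> (g i))" for I :: "'a set" and g
      by (induction I rule: infinite_finite_induct) (simp_all add: \<beta>_add \<beta>_0)
    \<comment> \<open>Each monomial is split into a scalar, on which \<open>\<beta>\<close> is the
      identity, and a semigroup element, on which it is \<open>\<xi>\<close>.\<close>
    have "\<beta> f = \<beta> (\<Sum>s\<in>Poly_Mapping.keys f.
        Poly_Mapping.single 0 (Poly_Mapping.lookup f s) * Poly_Mapping.single s 1)"
      by (simp add: mult_single sum_single_keys)
    also have "\<dots> = extend \<xi> f"
      unfolding \<beta>_sum \<beta>_mult \<beta>_const extend_def \<xi>_def ..
    finally show ?thesis ..
  qed
  show ?thesis
  proof (rule bexI[OF _ K], rule ballI)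
    fix f assume "f \<in> ?A"
    then show "extend \<xi> f = complex_of_real (\<alpha> f)" unfolding extend by (rule \<beta>_sym)
  qed
qed

section \<open>Closure in the seminorm topology\<close>

text \<open>Seminorm balls are open by the triangle inequality, so closure points are exactly those
  approximable in the seminorm; this matches \<open>N_closure\<close>.\<close>

lemma closure_of_phi_topology:
  assumes "\<And>s. 0 \<le> \<phi> s" "S \<subseteq> symmetric_elements star"
  shows "phi_topology star \<phi> closure_of S =
    {f \<in> symmetric_elements star. \<forall>\<epsilon>>0. \<exists>g\<in>S. phi_seminorm \<phi> (g - f) < \<epsilon>}"
proof (intro equalityI subsetI)
  fix f assume f: "f \<in> phi_topology star \<phi> closure_of S"
  then have fA: "f \<in> symmetric_elements star" by (simp add: in_closure_of topspace_phi_topology)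
  have "\<exists>g\<in>S. phi_seminorm \<phi> (g - f) < \<epsilon>" if e: "\<epsilon> > 0" for \<epsilon>
  proof -
    let ?U = "{g \<in> symmetric_elements star. phi_seminorm \<phi> (g - f) < \<epsilon>}"
    have "openin (phi_topology star \<phi>) ?U"
      unfolding openin_phi_topology
    proof (intro conjI ballI)
      fix g assume g: "g \<in> ?U"
      have "phi_seminorm \<phi> (k - f) < \<epsilon>" if "phi_seminorm \<phi> (k - g) < \<epsilon> - phi_seminorm \<phi> (g - f)" for k
        using that phi_seminorm_add[of \<phi> "k - g" "g - f", OF assms(1)] by simp
      then show "\<exists>\<delta>>0. \<forall>k\<in>symmetric_elements star. phi_seminorm \<phi> (k - g) < \<delta> \<longrightarrow> k \<in> ?U"
        using g by (intro exI[of _ "\<epsilon> - phi_seminorm \<phi> (g - f)"]) simp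
    qed blast
    moreover have "f \<in> ?U" using fA e by (simp add: phi_seminorm_def)
    ultimately have "\<exists>g. g \<in> S \<and> g \<in> ?U"
      by (intro conjunct2[OF iffD1[OF in_closure_of f], rule_format] conjI)
    then show ?thesis by auto
  qed
  with fA show "f \<in> {f \<in> symmetric_elements star. \<forall>\<epsilon>>0. \<exists>g\<in>S. phi_seminorm \<phi> (g - f) < \<epsilon>}" by blast
next
  fix f assume f: "f \<in> {f \<in> symmetric_elements star. \<forall>\<epsilon>>0. \<exists>g\<in>S. phi_seminorm \<phi> (g - f) < \<epsilon>}"
  have "\<exists>g. g \<in> S \<and> g \<in> U" if U: "f \<in> U" "openin (phi_topology star \<phi>) U" for U
  proof -
    obtain \<epsilon> where "\<epsilon> > 0" "\<forall>g\<in>symmetric_elements star. phi_seminorm \<phi> (g - f) < \<epsilon> \<longrightarrow> g \<in> U"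
      using U unfolding openin_phi_topology by blast
    then show ?thesis using f assms(2) by blast
  qed
  then show "f \<in> phi_topology star \<phi> closure_of S"
    using f by (auto simp: in_closure_of topspace_phi_topology)
qed

theorem theorem4p3:
  fixes star :: "'a::comm_monoid_add \<Rightarrow> 'a" and \<phi> :: "'a \<Rightarrow> real" and d :: nat
  assumes "semigroup_involution star"
    and "absolute_value star \<phi>"
    and "d \<ge> 1"
  shows "phi_topology star \<phi> closure_of sums_of_powers star (2 * d) = Pos star (K_phi star \<phi>)"
proof -
  interpret seminormed_real_algebra "symmetric_elements star" real_const "phi_seminorm \<phi>"
    by (rule seminormed_real_algebra_symmetric_elements[OF assms(1,2)])
  have nonneg: "0 \<le> \<phi> s" for s using assms(2) by (simp add: absolute_value_def)
  have "sums_of_powers star (2 * d) = power_sums (2 * d)"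
    by (simp add: sums_of_powers_def power_sums_def)
  then have closure: "phi_topology star \<phi> closure_of sums_of_powers star (2 * d) =
      N_closure (power_sums (2 * d))"
    using closure_of_phi_topology[OF nonneg power_sums_subset] by (simp add: N_closure_def)
  show ?thesis unfolding closure
  proof (intro equalityI subsetI)
    fix f assume f: "f \<in> N_closure (power_sums (2 * d))"
    then have fA: "f \<in> symmetric_elements star" by (simp add: N_closure_def)
    have "extend \<alpha> f \<in> \<real>\<^sub>\<ge>\<^sub>0" if \<alpha>: "\<alpha> \<in> K_phi star \<phi>" for \<alpha>
    proof -
      have semi: "\<alpha> \<in> semicharacters star" using \<alpha> by (simp add: K_phi_def)
      have pos: "0 \<le> Re (extend \<alpha> g)" if "g \<in> power_sums (2 * d)" for g
      proof -
        obtain n h where g: "g = (\<Sum>i<n::nat. h i ^ (2 * d))" "\<forall>i<n. h i \<in> symmetric_elements star"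
          using \<open>g \<in> power_sums (2 * d)\<close> by (auto simp: power_sums_def)
        \<comment> \<open>Symmetric elements take real values, so the even exponent makes each term
          nonnegative.\<close>
        have "0 \<le> Re (extend \<alpha> (h i) ^ (2 * d))" if "i < n" for i
        proof -
          obtain r where "extend \<alpha> (h i) = complex_of_real r"
            using extend_symmetric_real[OF semi, of "h i"] g(2) \<open>i < n\<close> by (auto elim: Reals_cases)
          then show ?thesis by (simp flip: of_real_power)
        qed
        then show ?thesis by (auto simp: g(1) extend_sum extend_power[OF semi] intro: sum_nonneg)
      qed
      have "0 \<le> Re (extend \<alpha> f)"
      proof (rule ccontr)
        assume "\<not> 0 \<le> Re (extend \<alpha> f)"
        \<comment> \<open>An approximant this close to \<open>f\<close> would still have a negative
          value at \<open>\<alpha>\<close>.\<close>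
        then obtain g where g: "g \<in> power_sums (2 * d)" "phi_seminorm \<phi> (g - f) < - Re (extend \<alpha> f)"
          using N_closureD[OF f, of "- Re (extend \<alpha> f)"] by auto
        have "Re (extend \<alpha> g) - Re (extend \<alpha> f) \<le> cmod (extend \<alpha> (g - f))"
          using complex_Re_le_cmod[of "extend \<alpha> (g - f)"] by (simp add: extend_diff)
        also have "\<dots> < - Re (extend \<alpha> f)" using cmod_extend_le[OF \<alpha>] g(2) by (rule le_less_trans)
        finally show False using pos[OF g(1)] by simp
      qed
      moreover have "Im (extend \<alpha> f) = 0"
        using extend_symmetric_real[OF semi fA] by (simp add: complex_is_Real_iff)
      ultimately show ?thesis by (simp add: complex_nonneg_Reals_iff)
    qed
    with fA show "f \<in> Pos star (K_phi star \<phi>)" by (simp add: Pos_def)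
  next
    fix f assume f: "f \<in> Pos star (K_phi star \<phi>)"
    show "f \<in> N_closure (power_sums (2 * d))"
    proof (rule closure_power_sums_contains)
      show "2 * d \<ge> 1" using assms(3) by simp
      show fA: "f \<in> symmetric_elements star" using f by (simp add: Pos_def)
      fix \<alpha> assume "real_character \<alpha>" "\<forall>a\<in>symmetric_elements star. \<bar>\<alpha> a\<bar> \<le> phi_seminorm \<phi> a"
      \<comment> \<open>A character bounded by the seminorm is evaluation at a point of
        \<open>K_phi\<close>, where \<open>f\<close> is nonnegative.\<close>
      then obtain \<xi> where "\<xi> \<in> K_phi star \<phi>" "extend \<xi> f = complex_of_real (\<alpha> f)"
        using real_character_extends[OF assms(1,2), of \<alpha>] fA by blast
      then show "0 \<le> \<alpha> f" using f by (auto simp: Pos_def)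
    qed
  qed
qed

end
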